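(* Let $R\preceq P$ be preorders on a set $X$. The following are equivalent: (a) $R$ is a positive sub-preorder of $P$: for any loop $$x=x_0\le_Rx_1\ge_Px_2\le_R\cdots\le_Rx_{2i-1}\ge_Px_{2i}\le_R\cdots\le_Rx_{2k-1}\ge_Px_{2k}=x,$$ the descending steps $x_{2i-1}\ge_Px_{2i}$ all satisfy $x_{2i-1}\ge_Rx_{2i}$. (b) $R$ is admissible in $P$: the set of bubbles of $P\vee R^{\mathrm{op}}$ and the set of bubbles of $R\vee R^{\mathrm{op}}$ are the same, and the restrictions of $R$ and $P$ to each connected component of $R$ coincide. (c) $R$ is a subdivision of $P$: $R=P\wedge(P^{\mathrm{op}}\vee R)$.
   Context: A preorder on $X$ is a reflexive transitive relation. $R\preceq P$ means $x\le_Ry\Rightarrow x\le_Py$. The opposite $P^{\mathrm{op}}$ is given by $x\le_{P^{\mathrm{op}}}y\Leftrightarrow y\le_Px$. The set of preorders on $X$ ordered by $\preceq$ is a lattice: the meet $P\wedge Q$ is given by $x\le y$ iff $x\le_Py$ and $x\le_Qy$; the join $P\vee Q$ is the transitive closure of the union of the two relations. The bubbles of a preorder are the classes of $x\sim y\Leftrightarrow x\le y\text{ and }y\le x$. The connected components are the classes of the equivalence relation generated by $\le$ (for $R$ these are the classes of the equivalence relation $R\vee R^{\mathrm{op}}$). In the paper, subdivision is defined as $R$ being in the image of $Q\mapsto P\wedge Q^{\mathrm{op}}$ for $Q\succeq P$, which is the same as $R=P\wedge(P^{\mathrm{op}}\vee R)$. *)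

theory Defs
  imports Main "HOL.Hull"
begin

text \<open>A preorder on \<open>X\<close> is a relation \<open>P\<close> with \<^term>\<open>preorder_on X P\<close>; \<open>(x, y) \<in> P\<close> is read as
  \<open>x \<le>\<^sub>P y\<close>. Thus \<open>\<preceq>\<close> is \<open>\<subseteq>\<close>, the opposite is \<open>P\<inverse>\<close> and the meet is \<open>P \<inter> Q\<close>.\<close>

definition pre_join :: "'a rel \<Rightarrow> 'a rel \<Rightarrow> 'a rel"
  where "pre_join P Q = (P \<union> Q)\<^sup>+"

lemma preorder_on_pre_join:
  assumes "preorder_on X P" and "preorder_on X Q"
  shows "preorder_on X (pre_join P Q)"
proof -
  have "P \<union> Q \<subseteq> X \<times> X" using assms unfolding preorder_on_def by blast
  then have "(P \<union> Q)\<^sup>+ \<subseteq> X \<times> X" by (rule trancl_subset_Sigma)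
  moreover have "refl_on X ((P \<union> Q)\<^sup>+)"
    using assms(1) unfolding preorder_on_def refl_on_def by blast
  ultimately show ?thesis unfolding preorder_on_def pre_join_def by simp
qed

lemma pre_join_least:
  assumes "preorder_on X T" and "P \<subseteq> T" and "Q \<subseteq> T"
  shows "pre_join P Q \<subseteq> T"
  using assms unfolding pre_join_def preorder_on_def
  by (metis Un_least trancl_id trancl_mono subsetI)

definition bubbles :: "'a set \<Rightarrow> 'a rel \<Rightarrow> 'a set set"
  where "bubbles X P = X // {(x, y). (x, y) \<in> P \<and> (y, x) \<in> P}"

text \<open>\<open>equiv X hull P\<close> is the intersection of all equivalence relations on \<open>X\<close> that contain \<open>P\<close>.\<close>

definition components :: "'a set \<Rightarrow> 'a rel \<Rightarrow> 'a set set"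
  where "components X P = X // (equiv X hull P)"

lemma equiv_hull_eq_pre_join:
  assumes "preorder_on X P"
  shows "equiv X hull P = pre_join P (P\<inverse>)"
proof
  have "preorder_on X (P\<inverse>)"
    using assms unfolding preorder_on_def refl_on_def by auto
  then have "preorder_on X (pre_join P (P\<inverse>))"
    by (rule preorder_on_pre_join[OF assms])
  moreover have "sym (pre_join P (P\<inverse>))"
    unfolding pre_join_def by (simp add: sym_Un_converse sym_trancl)
  ultimately have "equiv X (pre_join P (P\<inverse>))"
    unfolding equiv_def preorder_on_def by simp
  moreover have "P \<subseteq> pre_join P (P\<inverse>)" unfolding pre_join_def by auto
  ultimately show "equiv X hull P \<subseteq> pre_join P (P\<inverse>)" by (simp add: hull_minimal)
next
  show "pre_join P (P\<inverse>) \<subseteq> equiv X hull P"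
    unfolding hull_def
  proof (rule Inter_greatest)
    fix E assume "E \<in> {E. equiv X E \<and> P \<subseteq> E}"
    then have "preorder_on X E" "P \<subseteq> E" "P\<inverse> \<subseteq> E"
      unfolding equiv_def preorder_on_def sym_def by auto
    then show "pre_join P (P\<inverse>) \<subseteq> E" by (rule pre_join_least)
  qed
qed

text \<open>The loop has \<open>2 * k\<close> steps; step pair \<open>i < k\<close> is \<open>x\<^bsub>2i\<^esub> \<le>\<^sub>R x\<^bsub>2i+1\<^esub> \<ge>\<^sub>P x\<^bsub>2i+2\<^esub>\<close>.\<close>

definition positive_sub_preorder :: "'a rel \<Rightarrow> 'a rel \<Rightarrow> bool"
  where "positive_sub_preorder R P \<longleftrightarrow>
    (\<forall>(k::nat) (x :: nat \<Rightarrow> 'a).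
       x 0 = x (2 * k) \<and>
       (\<forall>i<k. (x (2 * i), x (2 * i + 1)) \<in> R \<and> (x (2 * i + 2), x (2 * i + 1)) \<in> P) \<longrightarrow>
       (\<forall>i<k. (x (2 * i + 2), x (2 * i + 1)) \<in> R))"

definition admissible :: "'a set \<Rightarrow> 'a rel \<Rightarrow> 'a rel \<Rightarrow> bool"
  where "admissible X R P \<longleftrightarrow>
    bubbles X (pre_join P (R\<inverse>)) = bubbles X (pre_join R (R\<inverse>)) \<and>
    (\<forall>C\<in>components X R. Restr R C = Restr P C)"

definition subdivision :: "'a set \<Rightarrow> 'a rel \<Rightarrow> 'a rel \<Rightarrow> bool"
  where "subdivision X R P \<longleftrightarrow> R \<in> (\<lambda>Q. P \<inter> Q\<inverse>) ` {Q. preorder_on X Q \<and> P \<subseteq> Q}"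

end

theory Submission
  imports Defs
begin

text \<open>Write \<open>J\<close> for \<open>pre_join (P\<inverse>) R\<close>: \<open>(x, y) \<in> J\<close> says that one can walk from \<open>x\<close> to \<open>y\<close> by
  going up along \<open>R\<close> and down along \<open>P\<close>. All the conditions are compared with the equation
  \<open>R = P \<inter> J\<close>, which says that a \<open>P\<close>-step whose reverse can be completed to a closed walk is an
  \<open>R\<close>-step.

  A preorder \<open>Q\<close> with \<open>P \<subseteq> Q\<close> and \<open>R \<subseteq> Q\<inverse>\<close> satisfies \<open>J \<subseteq> Q\<inverse>\<close>, and \<open>J\<inverse>\<close> is itself such a
  \<open>Q\<close>; hence the equation is equivalent to \<open>R\<close> being a subdivision
  (\<open>subdivision_iff_eq_meet\<close>).

  Every walk can be padded with trivial steps so that ascents in \<open>R\<close> and descents in \<open>P\<close>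
  alternate. A descent of an alternating loop is thus the same as a pair in \<open>P \<inter> J\<close>: the rest of
  the loop is the required walk. This gives the equivalence with positivity
  (\<open>positive_iff_eq_meet\<close>).

  For admissibility, the bubbles of \<open>P \<or> R\<^sup>o\<^sup>p\<close> are the classes of mutual reachability under
  \<open>J\<close>, and always contain those of \<open>R \<or> R\<^sup>o\<^sup>p\<close>. Two mutually reachable points lie on a closed
  walk, and the equation turns each of its descents into a descent of \<open>R\<close>, so that the walk stays
  in one component of \<open>R\<close>. Conversely a pair in \<open>P \<inter> J\<close> is mutually reachable, so admissibility
  puts it into a single component, where \<open>P\<close> and \<open>R\<close> agree (\<open>admissible_iff_eq_meet\<close>).\<close>

lemma preorder_on_converse: "preorder_on X P \<Longrightarrow> preorder_on X (P\<inverse>)"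
  by (auto simp: preorder_on_def refl_on_def)

lemma trans_pre_join: "trans (pre_join P Q)"
  by (simp add: pre_join_def)

lemma subset_pre_join: "P \<subseteq> pre_join P Q" "Q \<subseteq> pre_join P Q"
  by (auto simp: pre_join_def)

lemma converse_pre_join: "(pre_join P Q)\<inverse> = pre_join (P\<inverse>) (Q\<inverse>)"
  by (simp add: pre_join_def converse_Un flip: trancl_converse)

lemma equiv_mutual:
  assumes "preorder_on X P"
  shows "equiv X (P \<inter> P\<inverse>)"
proof -
  have "trans (P \<inter> P\<inverse>)"
    using assms by (simp add: preorder_on_def trans_Int)
  then show ?thesis
    using assms by (auto simp: preorder_on_def refl_on_def equiv_def sym_def)
qed

lemma bubbles_eq_quotient_mutual: "bubbles X P = X // (P \<inter> P\<inverse>)"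
proof -
  have "{(x, y). (x, y) \<in> P \<and> (y, x) \<in> P} = P \<inter> P\<inverse>" by auto
  then show ?thesis by (simp add: bubbles_def)
qed

lemma equiv_eq_of_quotient_eq:
  assumes "equiv X E" and "equiv X F" and "X // E = X // F"
  shows "E = F"
proof -
  have "(x, y) \<in> G \<longleftrightarrow> (\<exists>C\<in>X // G. x \<in> C \<and> y \<in> C)" if "equiv X G" for G x y
    using that by (metis equiv_class_eq_iff equiv_class_self quotientI in_quotient_imp_closed
        quotient_eq_iff)
  from this[OF assms(1)] this[OF assms(2)] assms(3) show ?thesis by auto
qed

lemma subdivision_iff_eq_meet:
  assumes "preorder_on X R" and "preorder_on X P" and "R \<subseteq> P"
  shows "subdivision X R P \<longleftrightarrow> R = P \<inter> pre_join (P\<inverse>) R"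
proof
  assume "subdivision X R P"
  then obtain Q where Q: "preorder_on X Q" "P \<subseteq> Q" "R = P \<inter> Q\<inverse>"
    by (auto simp: subdivision_def)
  then have "pre_join (P\<inverse>) R \<subseteq> Q\<inverse>"
    by (intro pre_join_least[OF preorder_on_converse]) auto
  then show "R = P \<inter> pre_join (P\<inverse>) R"
    using Q(3) subset_pre_join(2)[of R "P\<inverse>"] by blast
next
  assume eq: "R = P \<inter> pre_join (P\<inverse>) R"
  let ?Q = "(pre_join (P\<inverse>) R)\<inverse>"
  have "preorder_on X ?Q"
    using assms by (intro preorder_on_converse preorder_on_pre_join)
  moreover have "P \<subseteq> ?Q" using subset_pre_join(1)[of "P\<inverse>" R] by auto
  moreover have "R = P \<inter> ?Q\<inverse>" using eq by simp
  ultimately show "subdivision X R P" unfolding subdivision_def by blast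
qed

text \<open>A walk is brought into alternating form by inserting, where needed, a trivial ascent or
  descent; reflexivity on the common carrier supplies it.\<close>

lemma pre_join_subset_alternating:
  assumes "preorder_on X R" and "preorder_on X P"
  shows "pre_join (P\<inverse>) R \<subseteq> (R O P\<inverse>)\<^sup>*"
proof -
  have "P\<inverse> \<union> R \<subseteq> R O P\<inverse>"
    using assms unfolding preorder_on_def refl_on_def by blast
  then have "(P\<inverse> \<union> R)\<^sup>+ \<subseteq> (R O P\<inverse>)\<^sup>+"
    by (meson subsetI trancl_mono)
  then show ?thesis
    unfolding pre_join_def using trancl_into_rtrancl by fast
qed

lemma positive_iff_eq_meet:
  assumes "preorder_on X R" and "preorder_on X P" and "R \<subseteq> P"
  shows "positive_sub_preorder R P \<longleftrightarrow> R = P \<inter> pre_join (P\<inverse>) R"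
proof
  assume pos: "positive_sub_preorder R P"
  have "(y, z) \<in> R" if yz: "(y, z) \<in> P" "(y, z) \<in> pre_join (P\<inverse>) R" for y z
  proof -
    have "(y, z) \<in> (R O P\<inverse>)\<^sup>*"
      using pre_join_subset_alternating[OF assms(1,2)] yz(2) by auto
    then obtain n f where f: "f 0 = y" "f n = z" "\<forall>i<n. (f i, f (Suc i)) \<in> R O P\<inverse>"
      unfolding rtrancl_power relpow_fun_conv by blast
    have "\<forall>i<n. \<exists>m. (f i, m) \<in> R \<and> (f (Suc i), m) \<in> P" using f(3) by auto
    then obtain g where g: "\<And>i. i < n \<Longrightarrow> (f i, g i) \<in> R \<and> (f (Suc i), g i) \<in> P"
      by metis
    have zz: "(z, z) \<in> R"
      using yz assms(1,2) unfolding preorder_on_def refl_on_def by blast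
    \<comment> \<open>The walk is closed up by the trivial ascent at \<open>z\<close> and the descent from \<open>z\<close> to \<open>y\<close>, which
      is then the last descent of a loop with \<open>n + 1\<close> peaks.\<close>
    define x where "x j = (if even j then (f(Suc n := y)) (j div 2) else (g(n := z)) (j div 2))"
      for j
    have ev: "x (2 * i) = (f(Suc n := y)) i" and od: "x (2 * i + 1) = (g(n := z)) i"
      and ev2: "x (2 * i + 2) = (f(Suc n := y)) (Suc i)" for i
      by (simp_all add: x_def)
    have "x 0 = x (2 * Suc n)" using f(1) ev[of 0] ev[of "Suc n"] by simp
    moreover have "(x (2 * i), x (2 * i + 1)) \<in> R \<and> (x (2 * i + 2), x (2 * i + 1)) \<in> P"
      if "i < Suc n" for i
      unfolding ev od ev2 using that g[of i] f(2) zz yz(1) by (cases "i = n") auto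
    ultimately have "\<forall>i<Suc n. (x (2 * i + 2), x (2 * i + 1)) \<in> R"
      using pos unfolding positive_sub_preorder_def by blast
    then have "(x (2 * n + 2), x (2 * n + 1)) \<in> R" by blast
    then show ?thesis unfolding ev2 od by simp
  qed
  then show "R = P \<inter> pre_join (P\<inverse>) R"
    using assms(3) subset_pre_join(2)[of R "P\<inverse>"] by auto
next
  assume eq: "R = P \<inter> pre_join (P\<inverse>) R"
  show "positive_sub_preorder R P"
    unfolding positive_sub_preorder_def
  proof (intro allI impI, elim conjE)
    fix k i :: nat and x :: "nat \<Rightarrow> 'a"
    assume loop: "x 0 = x (2 * k)" and "i < k"
      and steps: "\<forall>i<k. (x (2 * i), x (2 * i + 1)) \<in> R \<and> (x (2 * i + 2), x (2 * i + 1)) \<in> P"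
    let ?W = "(P\<inverse> \<union> R)\<^sup>*"
    have walk: "(x (2 * a), x (2 * b)) \<in> ?W" if "a \<le> b" "b \<le> k" for a b
      using that
    proof (induction b rule: dec_induct)
      case base
      show ?case by simp
    next
      case (step b)
      then have "(x (2 * a), x (2 * b)) \<in> ?W" by simp
      moreover have "(x (2 * b), x (2 * b + 1)) \<in> P\<inverse> \<union> R"
        and "(x (2 * b + 1), x (2 * Suc b)) \<in> P\<inverse> \<union> R"
        using steps step by auto
      ultimately show ?case by (meson rtrancl.rtrancl_into_rtrancl)
    qed
    \<comment> \<open>Run through the loop from the foot of the given descent until its top is reached.\<close>
    have "(x (2 * Suc i), x (2 * k)) \<in> ?W" "(x (2 * 0), x (2 * i)) \<in> ?W"
      using \<open>i < k\<close> by (intro walk; simp)+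
    then have "(x (2 * i + 2), x (2 * i)) \<in> ?W"
      using loop by (simp add: rtrancl_trans)
    moreover have "(x (2 * i), x (2 * i + 1)) \<in> P\<inverse> \<union> R" using steps \<open>i < k\<close> by simp
    ultimately have "(x (2 * i + 2), x (2 * i + 1)) \<in> pre_join (P\<inverse>) R"
      unfolding pre_join_def by (rule rtrancl_into_trancl1)
    then show "(x (2 * i + 2), x (2 * i + 1)) \<in> R"
      using eq steps \<open>i < k\<close> by auto
  qed
qed

text \<open>The induction follows a walk from \<open>x\<close> to \<open>y\<close>; the way back from the end point keeps every
  initial segment of it mutually reachable, so that each descent of the walk, read
  upwards, is in \<open>P \<inter> pre_join (P\<inverse>) R\<close>.\<close>

lemma mutual_subset_component:
  assumes "P \<inter> pre_join (P\<inverse>) R \<subseteq> R"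
    and "(x, y) \<in> pre_join (P\<inverse>) R" and "(y, x) \<in> pre_join (P\<inverse>) R"
  shows "(x, y) \<in> pre_join R (R\<inverse>)"
proof -
  let ?J = "pre_join (P\<inverse>) R"
  have in_R: "(u, v) \<in> R \<union> R\<inverse>" if "(u, v) \<in> P\<inverse> \<union> R" "(v, u) \<in> ?J" for u v
    using that assms(1) by auto
  have "(x, y) \<in> (P\<inverse> \<union> R)\<^sup>+" using assms(2) by (simp add: pre_join_def)
  then have "(y, x) \<in> ?J \<longrightarrow> (x, y) \<in> (R \<union> R\<inverse>)\<^sup>+"
  proof (induction rule: trancl_induct)
    case (base y)
    then show ?case using in_R by blast
  next
    case (step y z)
    show ?case
    proof
      assume ret: "(z, x) \<in> ?J"
      have "(y, z) \<in> ?J" "(x, y) \<in> ?J"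
        using step.hyps unfolding pre_join_def by blast+
      then have "(y, x) \<in> ?J" "(z, y) \<in> ?J"
        using ret transD[OF trans_pre_join[of "P\<inverse>" R]] by blast+
      then have "(x, y) \<in> (R \<union> R\<inverse>)\<^sup>+" "(y, z) \<in> R \<union> R\<inverse>"
        using step.IH in_R[OF step.hyps(2)] by auto
      then show "(x, z) \<in> (R \<union> R\<inverse>)\<^sup>+" by (rule trancl_into_trancl)
    qed
  qed
  then show ?thesis using assms(3) by (simp add: pre_join_def)
qed

lemma admissible_iff_eq_meet:
  assumes "preorder_on X R" and "preorder_on X P" and "R \<subseteq> P"
  shows "admissible X R P \<longleftrightarrow> R = P \<inter> pre_join (P\<inverse>) R"
proof -
  define J where "J = pre_join (P\<inverse>) R"
  define E where "E = pre_join R (R\<inverse>)"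
  have preJ: "preorder_on X J" and preE: "preorder_on X E"
    using assms(1,2) unfolding J_def E_def
    by (simp_all add: preorder_on_pre_join preorder_on_converse)
  have symE: "E\<inverse> = E"
    unfolding E_def pre_join_def trancl_converse[symmetric]
    by (simp add: converse_Un sup_commute)
  have eqE: "equiv X E" using equiv_mutual[OF preE] symE by simp
  have PJ: "P\<inverse> \<subseteq> J" and RJ: "R \<subseteq> J"
    unfolding J_def by (rule subset_pre_join)+
  have EJ: "E \<subseteq> J"
    unfolding E_def using PJ RJ assms(3) by (intro pre_join_least[OF preJ]) auto
  have bubblesJ: "bubbles X (pre_join P (R\<inverse>)) = X // (J \<inter> J\<inverse>)"
    unfolding bubbles_eq_quotient_mutual J_def
    by (simp add: converse_pre_join Int_commute)
  have bubblesE: "bubbles X (pre_join R (R\<inverse>)) = X // E"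
    using symE by (simp add: bubbles_eq_quotient_mutual E_def)
  have bubbles_iff:
    "bubbles X (pre_join P (R\<inverse>)) = bubbles X (pre_join R (R\<inverse>)) \<longleftrightarrow> J \<inter> J\<inverse> = E"
    using equiv_eq_of_quotient_eq[OF equiv_mutual[OF preJ] eqE]
    unfolding bubblesJ bubblesE by metis
  have comps: "components X R = X // E"
    by (simp add: components_def equiv_hull_eq_pre_join[OF assms(1)] E_def)
  have restr_iff: "(\<forall>C\<in>components X R. Restr R C = Restr P C) \<longleftrightarrow> P \<inter> E \<subseteq> R"
  proof
    assume agree: "\<forall>C\<in>components X R. Restr R C = Restr P C"
    show "P \<inter> E \<subseteq> R"
    proof clarify
      fix x y assume xy: "(x, y) \<in> P" "(x, y) \<in> E"
      then have "x \<in> X" using eqE by (simp add: equiv_class_eq_iff)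
      then have "E `` {x} \<in> components X R" unfolding comps by (rule quotientI)
      moreover have "x \<in> E `` {x}" "y \<in> E `` {x}"
        using equiv_class_self[OF eqE \<open>x \<in> X\<close>] xy(2) by auto
      ultimately show "(x, y) \<in> R" using agree xy(1) by blast
    qed
  next
    assume PER: "P \<inter> E \<subseteq> R"
    show "\<forall>C\<in>components X R. Restr R C = Restr P C"
    proof
      fix C assume "C \<in> components X R"
      then have "C \<times> C \<subseteq> E"
        unfolding comps using quotient_eq_iff[OF eqE] by blast
      then show "Restr R C = Restr P C" using PER assms(3) by blast
    qed
  qed
  have "J \<inter> J\<inverse> = E \<and> P \<inter> E \<subseteq> R \<longleftrightarrow> R = P \<inter> J"
  proof
    assume adm: "J \<inter> J\<inverse> = E \<and> P \<inter> E \<subseteq> R"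
    have "P \<inter> J \<subseteq> J \<inter> J\<inverse>" using PJ converse_mono[of P "J\<inverse>"] by auto
    then have "P \<inter> J \<subseteq> P \<inter> E" using adm by simp
    then show "R = P \<inter> J" using adm RJ assms(3) by auto
  next
    assume eq: "R = P \<inter> J"
    have "J \<inter> J\<inverse> \<subseteq> E"
      using mutual_subset_component[of P R] equalityD2[OF eq] unfolding J_def E_def by blast
    moreover have "P \<inter> E \<subseteq> R" using EJ eq by auto
    moreover have "E \<subseteq> J \<inter> J\<inverse>" using EJ converse_mono[of E J] symE by simp
    ultimately show "J \<inter> J\<inverse> = E \<and> P \<inter> E \<subseteq> R" by simp
  qed
  then show ?thesis
    unfolding admissible_def bubbles_iff restr_iff J_def .
qed

theorem proposition6p6:
  fixes X :: "'a set" and R P :: "'a rel"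
  assumes "preorder_on X R" and "preorder_on X P" and "R \<subseteq> P"
  shows "(positive_sub_preorder R P \<longleftrightarrow> admissible X R P) \<and>
    (admissible X R P \<longleftrightarrow> subdivision X R P) \<and>
    (subdivision X R P \<longleftrightarrow> R = P \<inter> pre_join (P\<inverse>) R)"
  using positive_iff_eq_meet[OF assms] admissible_iff_eq_meet[OF assms]
    subdivision_iff_eq_meet[OF assms] by argo

end
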